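(* Let $v$ be a positive even integer such that $v/2$ is an odd prime. Let $(A,B)$ be a periodic Golay pair of length $v$, let $a=\sum_i a_i$ and $b=\sum_i b_i$ be the sums of the entries of $A$ and $B$ (so that $a^2+b^2=2v$), and let $(A^{(v/2)},B^{(v/2)})$ be its $(v/2)$-compression. Then $(A^{(v/2)},B^{(v/2)})$ is equivalent to $\bigl([\tfrac{a+b}{2},\tfrac{a-b}{2}],[\tfrac{a+b}{2},\tfrac{b-a}{2}]\bigr)$.
   Context: A periodic Golay pair of length $v$ is a pair of sequences $A=[a_0,\dots,a_{v-1}]$, $B=[b_0,\dots,b_{v-1}]$ with all entries in $\{-1,+1\}$ such that $\mathrm{PAF}(A,s)+\mathrm{PAF}(B,s)=0$ for $s=1,\dots,v/2$, where $\mathrm{PAF}(A,s)=\sum_{k=0}^{v-1}a_ka_{k+s}$ with indices modulo $v$. For a positive divisor $m$ of $v$, the $m$-compression of $A$ is the length-$v/m$ sequence $A^{(m)}$ with entries $a^{(m)}_k=\sum_{j=0}^{m-1}a_{k+j\,v/m}$; the $m$-compression of $(A,B)$ is $(A^{(m)},B^{(m)})$. Equivalence of pairs $(X,Y)$ of integer sequences of a common length $n$ is the equivalence relation generated by the operations: swapping $X$ and $Y$; cyclically shifting the entries of one of the sequences; reversing one of the sequences; decimation, replacing $x_i$ by $x_{ki \bmod n}$ and $y_i$ by $y_{ki\bmod n}$ for some $k$ coprime to $n$; alternating negation, replacing $x_i$ by $(-1)^ix_i$ and $y_i$ by $(-1)^iy_i$ (the negation of one sequence is obtainable from these). *)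

theory Defs
  imports Main "HOL-Computational_Algebra.Primes"
begin

definition PAF :: "int list \<Rightarrow> nat \<Rightarrow> int" where
  "PAF X s = (\<Sum>k<length X. X ! k * X ! ((k + s) mod length X))"

definition periodic_golay_pair :: "nat \<Rightarrow> int list \<Rightarrow> int list \<Rightarrow> bool" where
  "periodic_golay_pair v A B \<longleftrightarrow>
     length A = v \<and> length B = v \<and> set A \<subseteq> {-1, 1} \<and> set B \<subseteq> {-1, 1} \<and>
     (\<forall>s\<in>{1..v div 2}. PAF A s + PAF B s = 0)"

text \<open>Only meaningful when \<open>m\<close> is a positive divisor of \<open>length X\<close>.\<close>

definition compression :: "nat \<Rightarrow> int list \<Rightarrow> int list" where
  "compression m X =
     (let n = length X div m in map (\<lambda>k. \<Sum>j<m. X ! (k + j * n)) [0..<n])"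

definition decimation :: "nat \<Rightarrow> int list \<Rightarrow> int list" where
  "decimation k X = map (\<lambda>i. X ! (k * i mod length X)) [0..<length X]"

definition alternating_negation :: "int list \<Rightarrow> int list" where
  "alternating_negation X = map (\<lambda>i. (-1) ^ i * X ! i) [0..<length X]"

inductive pair_op :: "int list \<times> int list \<Rightarrow> int list \<times> int list \<Rightarrow> bool" where
  swap: "length X = length Y \<Longrightarrow> pair_op (X, Y) (Y, X)"
| shift_fst: "length X = length Y \<Longrightarrow> pair_op (X, Y) (rotate s X, Y)"
| shift_snd: "length X = length Y \<Longrightarrow> pair_op (X, Y) (X, rotate s Y)"
| reverse_fst: "length X = length Y \<Longrightarrow> pair_op (X, Y) (rev X, Y)"
| reverse_snd: "length X = length Y \<Longrightarrow> pair_op (X, Y) (X, rev Y)"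
| decimate: "length X = length Y \<Longrightarrow> coprime k (length X) \<Longrightarrow>
    pair_op (X, Y) (decimation k X, decimation k Y)"
| alternate: "length X = length Y \<Longrightarrow>
    pair_op (X, Y) (alternating_negation X, alternating_negation Y)"

definition equivalent_pairs ::
    "int list \<times> int list \<Rightarrow> int list \<times> int list \<Rightarrow> bool" where
  "equivalent_pairs = equivclp pair_op"

end

theory Submission
  imports Defs "HOL-Number_Theory.Cong"
begin

text \<open>
  Write \<open>[x\<^sub>0, x\<^sub>1]\<close> and \<open>[y\<^sub>0, y\<^sub>1]\<close> for the compressions and \<open>p = v/2\<close>. Summing the
  autocorrelations against the two characters \<open>s \<mapsto> (\<plusminus>1)\<^sup>s\<close> gives
  \<open>a\<^sup>2 + b\<^sup>2 = 4p = (x\<^sub>0 - x\<^sub>1)\<^sup>2 + (y\<^sub>0 - y\<^sub>1)\<^sup>2\<close>, where \<open>a = x\<^sub>0 + x\<^sub>1\<close> and \<open>b = y\<^sub>0 + y\<^sub>1\<close>. After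
  halving, these are two representations of the prime \<open>p\<close> as a sum of two squares, which must
  agree up to order and signs. Since \<open>x\<^sub>0\<close> is a sum of an odd number of signs, \<open>a/2\<close> and
  \<open>(x\<^sub>0 - x\<^sub>1)/2\<close> have different parity, so \<open>x\<^sub>0 - x\<^sub>1 = \<plusminus>b\<close> and \<open>y\<^sub>0 - y\<^sub>1 = \<plusminus>a\<close>. Cyclic shifts fix
  the signs.
\<close>

lemma bij_betw_add_mod:
  fixes k n :: nat
  shows "bij_betw (\<lambda>s. (k + s) mod n) {..<n} {..<n}"
proof -
  have "inj_on (\<lambda>s. (k + s) mod n) {..<n}"
  proof (rule inj_onI)
    fix s t assume "s \<in> {..<n}" "t \<in> {..<n}" and eq: "(k + s) mod n = (k + t) mod n"
    moreover have "s mod n = t mod n"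
      using eq by (metis cong_def cong_add_lcancel_nat)
    ultimately show "s = t" by simp
  qed
  moreover have "(\<lambda>s. (k + s) mod n) ` {..<n} \<subseteq> {..<n}" by auto
  ultimately show ?thesis
    by (metis bij_betw_imageI endo_inj_surj finite_lessThan)
qed

lemma sum_add_mod:
  fixes f :: "nat \<Rightarrow> 'a :: comm_monoid_add"
  shows "(\<Sum>s<n. f ((k + s) mod n)) = (\<Sum>s<n. f s)"
  by (rule sum.reindex_bij_betw[OF bij_betw_add_mod])

text \<open>Autocorrelation is symmetric: reindex by \<open>k\<close> to \<open>s + k\<close> modulo
  the length. A Golay pair is only constrained at shifts up to \<open>v div 2\<close>; this symmetry
  reaches the remaining nonzero shifts.\<close>

lemma PAF_diff:
  assumes "s \<le> length X"
  shows "PAF X (length X - s) = PAF X s"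
proof -
  let ?n = "length X"
  have "PAF X (?n - s) = (\<Sum>k<?n. X ! ((s + k) mod ?n) * X ! (((s + k) mod ?n + (?n - s)) mod ?n))"
    unfolding PAF_def by (rule sum_add_mod[symmetric])
  also have "\<dots> = (\<Sum>k<?n. X ! k * X ! ((k + s) mod ?n))"
  proof (rule sum.cong[OF refl])
    fix k assume "k \<in> {..<?n}"
    then have "((s + k) mod ?n + (?n - s)) mod ?n = k"
      using assms mod_add_left_eq[of "s + k" ?n "?n - s"] by simp
    then show "X ! ((s + k) mod ?n) * X ! (((s + k) mod ?n + (?n - s)) mod ?n)
        = X ! k * X ! ((k + s) mod ?n)"
      by (simp add: mult.commute add.commute)
  qed
  finally show ?thesis by (simp add: PAF_def)
qed

lemma power_mod_eq_power:
  fixes w :: "'a :: monoid_mult"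
  assumes "w ^ n = 1"
  shows "w ^ (m mod n) = w ^ m"
proof -
  have "w ^ m = w ^ (n * (m div n) + m mod n)" by simp
  then show ?thesis by (simp only: power_add power_mult assms power_one mult_1)
qed

text \<open>A Wiener-Khinchin identity: the transform of an autocorrelation is the squared modulus
  of the transform. Here \<open>wn\<close> makes \<open>w ^ s\<close> depend only on
  \<open>s\<close> modulo the length, and \<open>w2\<close> makes the character real, so the modulus
  squared is a plain square.\<close>

lemma sum_character_PAF:
  fixes w :: int
  assumes w2: "w\<^sup>2 = 1" and wn: "w ^ length X = 1"
  shows "(\<Sum>s<length X. w ^ s * PAF X s) = (\<Sum>k<length X. w ^ k * X ! k)\<^sup>2"
proof -
  let ?n = "length X"
  \<comment> \<open>A cyclic shift by \<open>k\<close> multiplies the transform by the inverse of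
    \<open>w ^ k\<close>, which is \<open>w ^ k\<close> itself.\<close>
  have inner: "(\<Sum>s<?n. w ^ s * X ! ((k + s) mod ?n)) = w ^ k * (\<Sum>s<?n. w ^ s * X ! s)" for k
  proof -
    have w: "w ^ k * w ^ ((k + s) mod ?n) = w ^ s" for s
    proof -
      have "w ^ k * w ^ (k + s) = (w\<^sup>2) ^ k * w ^ s"
        by (simp add: power_add power2_eq_square power_mult_distrib)
      then show ?thesis by (simp add: power_mod_eq_power[OF wn] w2)
    qed
    have "(\<Sum>s<?n. w ^ s * X ! ((k + s) mod ?n))
        = w ^ k * (\<Sum>s<?n. w ^ ((k + s) mod ?n) * X ! ((k + s) mod ?n))"
      by (simp add: sum_distrib_left mult.assoc[symmetric] w)
    then show ?thesis
      using sum_add_mod[of "\<lambda>t. w ^ t * X ! t" k ?n] by simp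
  qed
  have "(\<Sum>s<?n. w ^ s * PAF X s) = (\<Sum>s<?n. \<Sum>k<?n. X ! k * (w ^ s * X ! ((k + s) mod ?n)))"
    by (simp add: PAF_def sum_distrib_left mult.left_commute)
  also have "\<dots> = (\<Sum>k<?n. \<Sum>s<?n. X ! k * (w ^ s * X ! ((k + s) mod ?n)))"
    by (rule sum.swap)
  also have "\<dots> = (\<Sum>k<?n. X ! k * (w ^ k * (\<Sum>s<?n. w ^ s * X ! s)))"
    by (simp add: sum_distrib_left[symmetric] inner)
  also have "\<dots> = (\<Sum>k<?n. w ^ k * X ! k) * (\<Sum>s<?n. w ^ s * X ! s)"
    by (simp add: sum_distrib_right mult_ac)
  finally show ?thesis by (simp add: power2_eq_square)
qed

lemma PAF_0_signs:
  assumes "set X \<subseteq> {-1, 1}"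
  shows "PAF X 0 = int (length X)"
proof -
  have "X ! k * X ! (k mod length X) = 1" if "k < length X" for k
  proof -
    have "X ! k \<in> {-1, 1}" using assms nth_mem[OF that] by blast
    then show ?thesis using that by auto
  qed
  then show ?thesis by (simp add: PAF_def)
qed

text \<open>The transforms of the two autocorrelations add up to a sum in which every nonzero shift
  cancels; shift 0 contributes \<open>v\<close> for each sequence.\<close>

lemma golay_character_sum:
  fixes w :: int
  assumes g: "periodic_golay_pair v A B" and "v > 0" and "w\<^sup>2 = 1" and "w ^ v = 1"
  shows "(\<Sum>k<v. w ^ k * A ! k)\<^sup>2 + (\<Sum>k<v. w ^ k * B ! k)\<^sup>2 = 2 * int v"
proof -
  have len: "length A = v" "length B = v" and sgn: "set A \<subseteq> {-1, 1}" "set B \<subseteq> {-1, 1}"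
    and paf: "\<And>s. s \<in> {1..v div 2} \<Longrightarrow> PAF A s + PAF B s = 0"
    using g by (auto simp: periodic_golay_pair_def)
  have zero: "PAF A s + PAF B s = 0" if "0 < s" "s < v" for s
  proof (cases "s \<le> v div 2")
    case True
    then show ?thesis using paf[of s] that by auto
  next
    case False
    then have "v - s \<in> {1..v div 2}" using that by auto
    then show ?thesis
      using paf[of "v - s"] PAF_diff[of s A] PAF_diff[of s B] len that by simp
  qed
  have "(\<Sum>k<v. w ^ k * A ! k)\<^sup>2 + (\<Sum>k<v. w ^ k * B ! k)\<^sup>2
      = (\<Sum>s<v. w ^ s * (PAF A s + PAF B s))"
    using sum_character_PAF[of w A] sum_character_PAF[of w B] assms(3,4) len
    by (simp add: distrib_left sum.distrib)
  also have "\<dots> = (\<Sum>s\<in>{0}. w ^ s * (PAF A s + PAF B s))"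
    using \<open>v > 0\<close> by (intro sum.mono_neutral_right) (auto simp: zero)
  also have "\<dots> = 2 * int v"
    using PAF_0_signs[OF sgn(1)] PAF_0_signs[OF sgn(2)] len by simp
  finally show ?thesis .
qed

lemma sum_double_lessThan:
  fixes f :: "nat \<Rightarrow> 'a :: comm_monoid_add"
  shows "(\<Sum>i<2 * n. f i) = (\<Sum>j<n. f (2 * j)) + (\<Sum>j<n. f (Suc (2 * j)))"
  by (induction n) (simp_all add: add_ac)

lemma odd_sum_odd_iff:
  fixes f :: "nat \<Rightarrow> int"
  assumes "\<And>j. j < n \<Longrightarrow> odd (f j)"
  shows "odd (\<Sum>j<n. f j) \<longleftrightarrow> odd n"
  using assms by (induction n) auto

text \<open>The prime divides \<open>(e * h - f * g) * (e * h + f * g)\<close>, hence one factor. By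
  the two-squares product identity that factor belongs to a representation of
  \<open>p\<^sup>2\<close> as a sum of two squares, so one of the two terms vanishes.\<close>

lemma prime_sum_two_squares_unique:
  fixes p e f g h :: int
  assumes p: "prime p" and ef: "e\<^sup>2 + f\<^sup>2 = p" and gh: "g\<^sup>2 + h\<^sup>2 = p"
  shows "e\<^sup>2 = g\<^sup>2 \<or> e\<^sup>2 = h\<^sup>2"
proof -
  have p0: "p > 0" using p prime_gt_0_int by blast
  \<comment> \<open>Stated for arbitrary \<open>g\<close> and \<open>h\<close> so that the other
    factor is covered by replacing \<open>g\<close> with \<open>-g\<close>.\<close>
  have *: "e\<^sup>2 = g\<^sup>2 \<or> e\<^sup>2 = h\<^sup>2" if gh: "g\<^sup>2 + h\<^sup>2 = p" and dvd: "p dvd e * h - f * g" for g h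
  proof -
    have sq: "(e * h - f * g)\<^sup>2 + (e * g + f * h)\<^sup>2 = p\<^sup>2"
    proof -
      have "(e * h - f * g)\<^sup>2 + (e * g + f * h)\<^sup>2 = (e\<^sup>2 + f\<^sup>2) * (g\<^sup>2 + h\<^sup>2)"
        by (simp add: power2_eq_square algebra_simps)
      then show ?thesis using ef gh by (simp add: power2_eq_square)
    qed
    have "e * h - f * g = 0 \<or> e * g + f * h = 0"
    \<comment> \<open>If the second term is nonzero, the first is a multiple of \<open>p\<close> of
      absolute value below \<open>p\<close>, hence zero.\<close>
    proof (rule disjCI)
      assume "e * g + f * h \<noteq> 0"
      then have "(e * g + f * h)\<^sup>2 > 0" by simp
      then have "(e * h - f * g)\<^sup>2 < p\<^sup>2" using sq by linarith
      then have "\<bar>e * h - f * g\<bar> < p"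
        using p0 by (metis abs_of_pos abs_le_square_iff not_less)
      then show "e * h - f * g = 0"
        using dvd dvd_imp_le_int by (metis abs_of_pos not_less p0)
    qed
    then show ?thesis
    proof
      assume "e * h - f * g = 0"
      then have "e\<^sup>2 * h\<^sup>2 = f\<^sup>2 * g\<^sup>2" by (metis eq_iff_diff_eq_0 power_mult_distrib)
      then have "e\<^sup>2 * (g\<^sup>2 + h\<^sup>2) = (e\<^sup>2 + f\<^sup>2) * g\<^sup>2" by (simp add: algebra_simps)
      then show ?thesis using ef gh p0 by simp
    next
      assume "e * g + f * h = 0"
      then have "e * g = - (f * h)" by simp
      then have "e\<^sup>2 * g\<^sup>2 = f\<^sup>2 * h\<^sup>2" by (metis power2_minus power_mult_distrib)
      then have "e\<^sup>2 * (g\<^sup>2 + h\<^sup>2) = (e\<^sup>2 + f\<^sup>2) * h\<^sup>2" by (simp add: algebra_simps)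
      then show ?thesis using ef gh p0 by simp
    qed
  qed
  have "(e * h - f * g) * (e * h + f * g) = e\<^sup>2 * (g\<^sup>2 + h\<^sup>2) - (e\<^sup>2 + f\<^sup>2) * g\<^sup>2"
    by (simp add: power2_eq_square algebra_simps)
  also have "\<dots> = p * (e\<^sup>2 - g\<^sup>2)" using ef gh by (simp add: algebra_simps)
  finally have "p dvd (e * h - f * g) * (e * h + f * g)" by simp
  then have "p dvd e * h - f * g \<or> p dvd e * h + f * g"
    using p by (simp add: prime_dvd_mult_iff)
  then show ?thesis
  proof
    assume "p dvd e * h - f * g"
    then show ?thesis using * gh by blast
  next
    assume "p dvd e * h + f * g"
    then show ?thesis using *[of "-g" h] gh by simp
  qed
qed

lemma equivalent_pairs_rotate:
  assumes "length X = length Y"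
  shows "equivalent_pairs (X, Y) (rotate s X, rotate t Y)"
  unfolding equivalent_pairs_def
proof (rule equivclp_trans)
  show "equivclp pair_op (X, Y) (rotate s X, Y)"
    using assms by (intro r_into_equivclp pair_op.shift_fst)
  show "equivclp pair_op (rotate s X, Y) (rotate s X, rotate t Y)"
    using assms by (intro r_into_equivclp pair_op.shift_snd) simp
qed

lemma rotate_two_eq:
  assumes "(x = u \<and> y = w) \<or> (x = w \<and> y = u)"
  obtains s where "rotate s [x, y] = [u, w]"
proof -
  have "rotate 0 [x, y] = [u, w] \<or> rotate 1 [x, y] = [u, w]"
    using assms by auto
  then show ?thesis using that by blast
qed

(* a and b are sums of evenly many entries \<plusminus>1, hence even, so every "div 2" below is exact. *)
theorem mainTheorem4:
  fixes v :: nat and A B :: "int list" and a b :: int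
  assumes "v > 0" and "even v" and "prime (v div 2)" and "odd (v div 2)"
    and "periodic_golay_pair v A B"
    and "a = (\<Sum>i<v. A ! i)" and "b = (\<Sum>i<v. B ! i)"
  shows "a\<^sup>2 + b\<^sup>2 = 2 * int v \<and>
    equivalent_pairs (compression (v div 2) A, compression (v div 2) B)
      ([(a + b) div 2, (a - b) div 2], [(a + b) div 2, (b - a) div 2])"
proof -
  define p where "p = v div 2"
  have v: "v = 2 * p" and p0: "p > 0" using assms(1,2) by (auto simp: p_def)
  have len: "length A = v" "length B = v" and sgn: "set A \<subseteq> {-1, 1}" "set B \<subseteq> {-1, 1}"
    using assms(5) by (auto simp: periodic_golay_pair_def)
  define x0 x1 y0 y1 where "x0 = (\<Sum>j<p. A ! (2 * j))" and "x1 = (\<Sum>j<p. A ! Suc (2 * j))"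
    and "y0 = (\<Sum>j<p. B ! (2 * j))" and "y1 = (\<Sum>j<p. B ! Suc (2 * j))"
  note defs = x0_def x1_def y0_def y1_def
  \<comment> \<open>The compressed length is \<open>v div p = 2\<close>, so the two entries collect
    the even and the odd positions.\<close>
  have compr: "compression p A = [x0, x1]" "compression p B = [y0, y1]"
    using p0 by (simp_all add: compression_def Let_def len v defs upt_rec mult.commute)
  have oddA: "odd (A ! i)" if "i < v" for i
  proof -
    have "A ! i \<in> {-1, 1}" using nth_mem[of i A] that len sgn by (metis subsetD)
    then show ?thesis by auto
  qed
  have oddB: "odd (B ! i)" if "i < v" for i
  proof -
    have "B ! i \<in> {-1, 1}" using nth_mem[of i B] that len sgn by (metis subsetD)
    then show ?thesis by auto
  qed
  have odd: "odd x0" "odd x1" "odd y0" "odd y1"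
    unfolding defs using assms(4) oddA oddB by (subst odd_sum_odd_iff; simp add: p_def[symmetric] v)+
  have a: "a = x0 + x1" and b: "b = y0 + y1"
    by (simp_all add: assms(6,7) v sum_double_lessThan defs)
  have sum_ab: "a\<^sup>2 + b\<^sup>2 = 2 * int v"
    using golay_character_sum[OF assms(5,1), of 1] by (simp add: assms(6,7))
  \<comment> \<open>The character -1 is admissible because \<open>v\<close> is even; it weights even
    positions by 1 and odd ones by -1.\<close>
  have diff: "(x0 - x1)\<^sup>2 + (y0 - y1)\<^sup>2 = 2 * int v"
    using golay_character_sum[OF assms(5,1), of "-1"]
    by (simp add: v sum_double_lessThan defs sum_negf)
  obtain e f where e: "a = 2 * e" and f: "b = 2 * f"
    using odd a b by (metis odd_even_add evenE)
  obtain g h where g: "x0 - x1 = 2 * g" and h: "y0 - y1 = 2 * h"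
    using odd by (metis even_diff odd_even_add evenE)
  have ef: "e\<^sup>2 + f\<^sup>2 = int p" using sum_ab by (simp add: e f v power_mult_distrib)
  have gh: "g\<^sup>2 + h\<^sup>2 = int p" using diff by (simp add: g h v power_mult_distrib)
  have x: "x0 = e + g" "x1 = e - g" and y: "y0 = f + h" "y1 = f - h"
    using a b e f g h by auto
  \<comment> \<open>Equal squares would give \<open>e\<close> and \<open>g\<close> the same parity
    and make \<open>x0 = e + g\<close> even.\<close>
  have "e\<^sup>2 \<noteq> g\<^sup>2"
  proof
    assume "e\<^sup>2 = g\<^sup>2"
    then have "even e = even g" by (metis even_power zero_less_numeral)
    then show False using odd(1) x by simp
  qed
  then have eh: "e\<^sup>2 = h\<^sup>2"
    using prime_sum_two_squares_unique[OF _ ef gh] assms(3) by (simp add: p_def)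
  then have fg: "f\<^sup>2 = g\<^sup>2" using ef gh by simp
  \<comment> \<open>Since \<open>g\<close> is \<open>f\<close> or \<open>-f\<close>, its sign only
    decides the order of the two entries, which a shift can swap.\<close>
  have "(x0 = e + f \<and> x1 = e - f) \<or> (x0 = e - f \<and> x1 = e + f)"
    using fg x by (auto simp: power2_eq_iff)
  then obtain s where s: "rotate s [x0, x1] = [e + f, e - f]" by (rule rotate_two_eq)
  have "(y0 = e + f \<and> y1 = f - e) \<or> (y0 = f - e \<and> y1 = e + f)"
    using eh y by (auto simp: power2_eq_iff)
  then obtain t where t: "rotate t [y0, y1] = [e + f, f - e]" by (rule rotate_two_eq)
  have "(a + b) div 2 = e + f" "(a - b) div 2 = e - f" "(b - a) div 2 = f - e"
    by (simp_all add: e f)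
  then show ?thesis
    using sum_ab equivalent_pairs_rotate[of "[x0, x1]" "[y0, y1]" s t] s t compr
    by (simp add: p_def)
qed

end
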